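(* Let $I\subset\mathbb{R}^{n+m}$ be a hyperrectangle and $f:I\to\mathbb{R}^n$ a nonlinear function. Let $\mathcal{V}=\{v_1,\dots,v_l\}$ be the set of grid points of a uniform mesh of $I$, with $v_i=(x_i,u_i)$, and let $\mathcal{C}=\{v^c_1,\dots,v^c_{2^{n+m}}\}$ be the set of corner points (vertices) of $I$, with $v^c_j=(x^c_j,u^c_j)$, where $x_i,x_j^c\in\mathbb{R}^n$ and $u_i,u_j^c\in\mathbb{R}^m$. Let $\sigma\in\mathbb{R}^n$ be the vector of interpolation error bounds of $f$ for this mesh (defined in the context). Let $(\theta,\overline{A},\underline{A},\overline{B},\underline{B},h_u,h_b)$, with $\theta\in\mathbb{R}$, $\overline{A},\underline{A}\in\mathbb{R}^{n\times n}$, $\overline{B},\underline{B}\in\mathbb{R}^{n\times m}$, $h_u,h_b\in\mathbb{R}^n$, be an optimal solution of the linear program $$\min_{\theta,\overline{A},\underline{A},\overline{B},\underline{B},h_u,h_b}\ \theta$$ subject to, for all $i\in\{1,\dots,l\}$ and all $j\in\{1,\dots,2^{n+m}\}$, $$\overline{A}x_i+\overline{B}u_i+h_u\ \ge\ f(x_i,u_i),$$ $$\underline{A}x_i+\underline{B}u_i+h_b\ \le\ f(x_i,u_i),$$ $$(\overline{A}-\underline{A})x^c_j+(\overline{B}-\underline{B})u^c_j+h_u-h_b\ \le\ \theta\,\mathbf{1}_n,$$ where $\mathbf{1}_n\in\mathbb{R}^n$ is the vector of ones. Define the affine functions $f_u(x,u)=\overline{A}x+\overline{B}u+h_u$, $f_b(x,u)=\underline{A}x+\underline{B}u+h_b$,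 and $$\overline{f}=f_u+\sigma,\qquad \underline{f}=f_b-\sigma .$$ Then $\overline{f}$ and $\underline{f}$ over-approximate (abstract) $f$ on $I$, i.e. $$\underline{f}(x,u)\le f(x,u)\le\overline{f}(x,u)\qquad\text{for all }(x,u)\in I .$$
   Context: All inequalities between vectors are componentwise. Points of $\mathbb{R}^{n+m}$ are written $(x,u)$ with $x\in\mathbb{R}^n$, $u\in\mathbb{R}^m$. A hyperrectangle is a set $I=\prod_{j=1}^{n+m}[a_j,b_j]$ with $a_j<b_j$. Uniform mesh: for an integer resolution $r\ge 2$, the grid points are all points whose $j$-th coordinate is one of the $r$ equally spaced values in $[a_j,b_j]$ (endpoints included), for every $j$. The grid divides $I$ into congruent hyperrectangular mesh elements. Each mesh element $\prod_j[c_j,c_j+h_j]$ is further divided into $(n+m)$-dimensional simplices with vertices among the vertices of the element: for each permutation $(j_1,\dots,j_{n+m})$ of $\{1,\dots,n+m\}$, take $\{z: 0\le (z_{j_1}-c_{j_1})/h_{j_1}\le\cdots\le (z_{j_{n+m}}-c_{j_{n+m}})/h_{j_{n+m}}\le 1\}$. These simplices have the same diameter (greatest distance between two vertices) $\delta$ as the mesh element. Let $\delta_s$ be the simplex ball radius, i.e. the radius of the smallest closed Euclidean ball containing a simplex (the maximum over the simplices of the mesh); it satisfies $\delta_s\le\sqrt{\frac{n+m}{2(n+m+1)}}\,\delta$. Error bound vector: $f$ is continuous, and each component $f_k$ of $f$ belongs to one or more of the classes $C^0$, Lipschitz continuous, $C^1$, $C^2$ on $I$. Let $\lambda_k$ be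 the Lipschitz constant of $f_k$ on $I$ with respect to the Euclidean norm, $f_k'$ its Jacobian (gradient), $f_k''$ its Hessian, and $\|\cdot\|_2$ the Euclidean (induced) norm. The component $\sigma_k$ of $\sigma\in\mathbb{R}^n$ is the smallest among those of the following bounds that apply to $f_k$: (i) $2\lambda_k\delta_s$ if $f_k\in C^0$; (ii) $\lambda_k\delta_s$ if $f_k$ is Lipschitz continuous; (iii) $\delta_s\max_{s\in I}\|f_k'(s)\|_2$ if $f_k\in C^1$; (iv) $\frac12\delta_s^2\max_{s\in I}\|f_k''(s)\|_2$ if $f_k\in C^2$. All the constants involved are assumed finite (in particular $\lambda_k<\infty$), and $C^1$, $C^2$ on the closed set $I$ mean that the derivatives extend continuously to $I$. *)

theory Defs
  imports "HOL-Analysis.Analysis"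
begin

section \<open>Uniform meshes of a hyperrectangle \<open>cbox a b\<close>\<close>

definition corner_points :: "'a::euclidean_space \<Rightarrow> 'a \<Rightarrow> 'a set" where
  "corner_points a b = {z. \<forall>i\<in>Basis. z \<bullet> i = a \<bullet> i \<or> z \<bullet> i = b \<bullet> i}"

definition mesh_step :: "'a::euclidean_space \<Rightarrow> 'a \<Rightarrow> nat \<Rightarrow> 'a" where
  "mesh_step a b r = (1 / (real r - 1)) *\<^sub>R (b - a)"

definition grid_points :: "'a::euclidean_space \<Rightarrow> 'a \<Rightarrow> nat \<Rightarrow> 'a set" where
  "grid_points a b r =
     {z. \<forall>i\<in>Basis. \<exists>k<r. z \<bullet> i = a \<bullet> i + real k * (mesh_step a b r \<bullet> i)}"

text \<open>The lower corners \<open>c\<close> of the mesh elements \<open>cbox c (c + mesh_step a b r)\<close>.\<close>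

definition element_corners :: "'a::euclidean_space \<Rightarrow> 'a \<Rightarrow> nat \<Rightarrow> 'a set" where
  "element_corners a b r =
     {c. \<forall>i\<in>Basis. \<exists>k. Suc k < r \<and> c \<bullet> i = a \<bullet> i + real k * (mesh_step a b r \<bullet> i)}"

text \<open>A permutation of the coordinates is given as a list enumerating the standard basis.\<close>

definition element_simplex :: "'a::euclidean_space \<Rightarrow> 'a \<Rightarrow> 'a list \<Rightarrow> 'a set" where
  "element_simplex c h js = {z. sorted (0 # map (\<lambda>i. (z \<bullet> i - c \<bullet> i) / (h \<bullet> i)) js @ [1])}"

definition mesh_simplices :: "'a::euclidean_space \<Rightarrow> 'a \<Rightarrow> nat \<Rightarrow> 'a set set" where
  "mesh_simplices a b r =
     {element_simplex c (mesh_step a b r) js | c js.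
        c \<in> element_corners a b r \<and> distinct js \<and> set js = Basis}"

definition min_ball_radius :: "'a::euclidean_space set \<Rightarrow> real" where
  "min_ball_radius S = Inf {\<rho>. \<exists>c. S \<subseteq> cball c \<rho>}"

definition simplex_ball_radius :: "'a::euclidean_space \<Rightarrow> 'a \<Rightarrow> nat \<Rightarrow> real" where
  "simplex_ball_radius a b r = Max (min_ball_radius ` mesh_simplices a b r)"

lemma finite_coordinatewise:
  fixes S :: "'a::euclidean_space \<Rightarrow> real set"
  assumes "\<And>i. i \<in> Basis \<Longrightarrow> finite (S i)"
  shows "finite {z. \<forall>i\<in>Basis. z \<bullet> i \<in> S i}"
proof (rule finite_surj)
  show "finite (PiE Basis S)"
    using assms by (intro finite_PiE finite_Basis)
  show "{z. \<forall>i\<in>Basis. z \<bullet> i \<in> S i} \<subseteq> (\<lambda>c. \<Sum>i\<in>Basis. c i *\<^sub>R i) ` PiE Basis S"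
  proof
    fix z :: 'a
    assume z: "z \<in> {z. \<forall>i\<in>Basis. z \<bullet> i \<in> S i}"
    have "(\<Sum>i\<in>Basis. restrict (\<lambda>i. z \<bullet> i) Basis i *\<^sub>R i) = (\<Sum>i\<in>Basis. (z \<bullet> i) *\<^sub>R i)"
      by (intro sum.cong) simp_all
    also have "\<dots> = z"
      by (rule euclidean_representation)
    finally have "z = (\<Sum>i\<in>Basis. restrict (\<lambda>i. z \<bullet> i) Basis i *\<^sub>R i)"
      by (rule sym)
    moreover have "restrict (\<lambda>i. z \<bullet> i) Basis \<in> PiE Basis S"
      using z by (simp add: PiE_iff)
    ultimately show "z \<in> (\<lambda>c. \<Sum>i\<in>Basis. c i *\<^sub>R i) ` PiE Basis S"
      by (rule image_eqI)
  qed
qed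

lemma finite_mesh_simplices: "finite (mesh_simplices a b r)"
proof -
  let ?h = "mesh_step a b r"
  have "element_corners a b r \<subseteq>
      {z. \<forall>i\<in>Basis. z \<bullet> i \<in> (\<lambda>k. a \<bullet> i + real k * (?h \<bullet> i)) ` {..<r}}"
    unfolding element_corners_def by (blast intro: Suc_lessD)
  moreover have "finite {z. \<forall>i\<in>Basis. z \<bullet> i \<in> (\<lambda>k. a \<bullet> i + real k * (?h \<bullet> i)) ` {..<r}}"
    by (rule finite_coordinatewise) auto
  ultimately have "finite (element_corners a b r)"
    by (rule finite_subset)
  moreover have "{js. set js = (Basis::'a set) \<and> distinct js} \<subseteq> {js. set js \<subseteq> Basis \<and> distinct js}"
    by blast
  then have "finite {js. set js = (Basis::'a set) \<and> distinct js}"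
    by (rule finite_subset) (rule finite_subset_distinct[OF finite_Basis])
  ultimately have "finite ((\<lambda>(c, js). element_simplex c ?h js) `
      (element_corners a b r \<times> {js. set js = Basis \<and> distinct js}))"
    by (intro finite_imageI finite_cartesian_product)
  moreover have "mesh_simplices a b r \<subseteq> (\<lambda>(c, js). element_simplex c ?h js) `
      (element_corners a b r \<times> {js. set js = Basis \<and> distinct js})"
    unfolding mesh_simplices_def by blast
  ultimately show ?thesis
    by (rule rev_finite_subset)
qed

section \<open>Interpolation error bounds\<close>

text \<open>The optimal Lipschitz constant; meaningful only if \<open>g\<close> is Lipschitz on \<open>X\<close>.\<close>

definition lipschitz_const :: "'a::metric_space set \<Rightarrow> ('a \<Rightarrow> real) \<Rightarrow> real" where
  "lipschitz_const X g = Inf {L. L-lipschitz_on X g}"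

text \<open>\<open>g\<close> is \<open>C\<^sup>1\<close> (\<open>C\<^sup>2\<close>) on the closed set \<open>X\<close> if it is so on the interior and its
  derivatives extend continuously to \<open>X\<close>. The relations below say that \<open>G\<close> (\<open>H\<close>) is the
  extended gradient (Hessian); it is determined on \<open>X\<close> when \<open>X\<close> is the closure of its
  interior. The norm of a Hessian, a value of type \<^typ>\<open>'a \<Rightarrow>\<^sub>L 'a\<close>, is the operator norm
  induced by the Euclidean norm.\<close>

definition C1_gradient_on ::
    "'a::euclidean_space set \<Rightarrow> ('a \<Rightarrow> real) \<Rightarrow> ('a \<Rightarrow> 'a) \<Rightarrow> bool" where
  "C1_gradient_on X g G \<longleftrightarrow>
     continuous_on X g \<and> continuous_on X G \<and>
     (\<forall>s\<in>interior X. (g has_derivative (\<lambda>v. G s \<bullet> v)) (at s))"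

definition C2_hessian_on ::
    "'a::euclidean_space set \<Rightarrow> ('a \<Rightarrow> real) \<Rightarrow> ('a \<Rightarrow> 'a \<Rightarrow>\<^sub>L 'a) \<Rightarrow> bool" where
  "C2_hessian_on X g H \<longleftrightarrow>
     (\<exists>G. C1_gradient_on X g G \<and> continuous_on X H \<and>
       (\<forall>s\<in>interior X. (G has_derivative blinfun_apply (H s)) (at s)))"

text \<open>The bounds that apply to \<open>g\<close>. The last two sets have at most one element, since gradient
  and Hessian are determined on a hyperrectangle.\<close>

definition applicable_bounds ::
    "'a::euclidean_space set \<Rightarrow> real \<Rightarrow> ('a \<Rightarrow> real) \<Rightarrow> real set" where
  "applicable_bounds X \<delta>\<^sub>s g =
     (if continuous_on X g then {2 * lipschitz_const X g * \<delta>\<^sub>s} else {}) \<union>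
     (if \<exists>L. L-lipschitz_on X g then {lipschitz_const X g * \<delta>\<^sub>s} else {}) \<union>
     {\<delta>\<^sub>s * (SUP s\<in>X. norm (G s)) | G. C1_gradient_on X g G} \<union>
     {1 / 2 * \<delta>\<^sub>s\<^sup>2 * (SUP s\<in>X. norm (H s)) | H. C2_hessian_on X g H}"

definition error_bound ::
    "'a::euclidean_space \<Rightarrow> 'a \<Rightarrow> nat \<Rightarrow> ('a \<Rightarrow> real ^ 'n) \<Rightarrow> real ^ 'n" where
  "error_bound a b r f =
     (\<chi> k. Min (applicable_bounds (cbox a b) (simplex_ball_radius a b r) (\<lambda>z. f z $ k)))"

lemma C1_gradient_on_unique:
  assumes "C1_gradient_on X g G" "C1_gradient_on X g G'" "X \<subseteq> closure (interior X)" "s \<in> X"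
  shows "G s = G' s"
proof -
  have eq: "G t = G' t" if "t \<in> interior X" for t
  proof -
    have "(\<lambda>v. G t \<bullet> v) = (\<lambda>v. G' t \<bullet> v)"
      using assms(1,2) that unfolding C1_gradient_on_def by (blast intro: has_derivative_unique)
    then have "\<forall>v. G t \<bullet> v = G' t \<bullet> v"
      by (simp add: fun_eq_iff)
    then show ?thesis
      by (simp add: vector_eq_rdot)
  qed
  obtain t where t: "\<And>n. t n \<in> interior X" "t \<longlonglongrightarrow> s"
    using subsetD[OF assms(3,4)] unfolding closure_sequential by blast
  then have tX: "\<And>n. t n \<in> X"
    using interior_subset by blast
  have "(\<lambda>n. G (t n)) \<longlonglongrightarrow> G s" "(\<lambda>n. G' (t n)) \<longlonglongrightarrow> G' s"
    using assms(1,2,4) t(2) tX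
    unfolding C1_gradient_on_def continuous_on_sequentially o_def by blast+
  moreover have "(\<lambda>n. G (t n)) = (\<lambda>n. G' (t n))"
    using eq t(1) by blast
  ultimately show ?thesis
    using LIMSEQ_unique by metis
qed

lemma C2_hessian_on_unique:
  assumes "C2_hessian_on X g H" "C2_hessian_on X g H'" "X \<subseteq> closure (interior X)" "s \<in> X"
  shows "H s = H' s"
proof -
  obtain G where G: "C1_gradient_on X g G" "continuous_on X H"
      "\<And>s. s \<in> interior X \<Longrightarrow> (G has_derivative blinfun_apply (H s)) (at s)"
    using assms(1) by (auto simp: C2_hessian_on_def)
  obtain G' where G': "C1_gradient_on X g G'" "continuous_on X H'"
      "\<And>s. s \<in> interior X \<Longrightarrow> (G' has_derivative blinfun_apply (H' s)) (at s)"
    using assms(2) by (auto simp: C2_hessian_on_def)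
  have eq: "H t = H' t" if t: "t \<in> interior X" for t
  proof -
    have "(G' has_derivative blinfun_apply (H t)) (at t)"
    proof (rule has_derivative_transform_within_open[OF G(3)[OF t] open_interior t])
      show "G x = G' x" if "x \<in> interior X" for x
        using C1_gradient_on_unique[OF G(1) G'(1) assms(3)] that interior_subset by blast
    qed
    then have "blinfun_apply (H t) = blinfun_apply (H' t)"
      using G'(3)[OF t] by (rule has_derivative_unique)
    then show ?thesis
      by (simp add: blinfun_apply_inject)
  qed
  obtain t where t: "\<And>n. t n \<in> interior X" "t \<longlonglongrightarrow> s"
    using subsetD[OF assms(3,4)] unfolding closure_sequential by blast
  then have tX: "\<And>n. t n \<in> X"
    using interior_subset by blast
  have "(\<lambda>n. H (t n)) \<longlonglongrightarrow> H s" "(\<lambda>n. H' (t n)) \<longlonglongrightarrow> H' s"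
    using G(2) G'(2) assms(4) t(2) tX
    unfolding continuous_on_sequentially o_def by blast+
  moreover have "(\<lambda>n. H (t n)) = (\<lambda>n. H' (t n))"
    using eq t(1) by blast
  ultimately show ?thesis
    using LIMSEQ_unique by metis
qed

section \<open>The linear program\<close>

text \<open>\<open>real ^ 'm ^ 'n\<close> is the type of matrices with rows indexed by \<open>'n\<close> and columns by \<open>'m\<close>;
  the order on \<open>real ^ 'n\<close> is componentwise and \<open>1 :: real ^ 'n\<close> is the vector of ones.\<close>

type_synonym ('n, 'm) lp_point =
  "real \<times> (real ^ 'n ^ 'n) \<times> (real ^ 'n ^ 'n) \<times> (real ^ 'm ^ 'n) \<times> (real ^ 'm ^ 'n) \<times>
   (real ^ 'n) \<times> (real ^ 'n)"

definition lp_feasible ::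
    "((real ^ 'n) \<times> (real ^ 'm)) set \<Rightarrow> ((real ^ 'n) \<times> (real ^ 'm)) set \<Rightarrow>
     ((real ^ 'n) \<times> (real ^ 'm) \<Rightarrow> real ^ 'n) \<Rightarrow> ('n::finite, 'm::finite) lp_point \<Rightarrow> bool" where
  "lp_feasible V C f = (\<lambda>(\<theta>, Au, Al, Bu, Bl, hu, hb).
     (\<forall>(x, u)\<in>V. Au *v x + Bu *v u + hu \<ge> f (x, u)) \<and>
     (\<forall>(x, u)\<in>V. Al *v x + Bl *v u + hb \<le> f (x, u)) \<and>
     (\<forall>(x, u)\<in>C. (Au - Al) *v x + (Bu - Bl) *v u + hu - hb \<le> \<theta> *\<^sub>R 1))"

definition lp_optimal ::
    "((real ^ 'n) \<times> (real ^ 'm)) set \<Rightarrow> ((real ^ 'n) \<times> (real ^ 'm)) set \<Rightarrow>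
     ((real ^ 'n) \<times> (real ^ 'm) \<Rightarrow> real ^ 'n) \<Rightarrow> ('n::finite, 'm::finite) lp_point \<Rightarrow> bool" where
  "lp_optimal V C f p \<longleftrightarrow>
     lp_feasible V C f p \<and> (\<forall>q. lp_feasible V C f q \<longrightarrow> fst p \<le> fst q)"

end

theory Submission
  imports Defs
begin

text \<open>
  Every point \<open>z\<close> of the hyperrectangle lies in some simplex \<open>S\<close> of the mesh, and is therefore a
  convex combination \<open>z = (\<Sum>v. w v *\<^sub>R v)\<close> of vertices of \<open>S\<close>, which are grid points. An affine
  function takes at \<open>z\<close> the same combination of its values at the vertices, and feasibility for the
  linear program orders \<open>f\<close> and the two affine functions at the vertices. Hence only the error
  \<open>\<bar>(\<Sum>v. w v * f v $ k) - f z $ k\<bar>\<close> of linear interpolation has to be compared with \<open>\<sigma> $ k\<close>.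

  All the error bounds come from a single fact about the weights: their second moment about \<open>z\<close>,
  \<open>\<Sum>v. w v * (norm (v - z))\<^sup>2\<close>, is at most \<open>\<rho>\<^sup>2\<close> for every ball of radius \<open>\<rho>\<close> that contains \<open>S\<close>
  (\<open>weighted_sq_dist_le_ball\<close>). Indeed \<open>z\<close> is the mean of the vertices, so their second moment about
  \<open>z\<close> is at most the one about the centre of the ball. Now consider each smoothness class.

  \<^item> A function with Lipschitz constant \<open>\<lambda>\<close> has error at most \<open>\<lambda>\<close> times the mean distance of the
    vertices from \<open>z\<close>, and the square of that mean is at most the second moment. The bound for
    continuous functions is twice this one.
  \<^item> A \<open>C\<^sup>1\<close> function is Lipschitz with constant the largest norm of its gradient.
  \<^item> For a \<open>C\<^sup>2\<close> function, expand around \<open>z\<close>: the first order terms \<open>G z \<bullet> (v - z)\<close> cancel in the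
    weighted sum, and the remainders are bounded by \<open>M / 2\<close> times the squared distances, with \<open>M\<close>
    the largest norm of the Hessian.

  Derivatives are only given in the interior, while the segment from \<open>z\<close> to a vertex may run inside
  the boundary. The estimates are therefore proved in the interior, which is convex, and pass to the
  hyperrectangle by continuity.
\<close>

section \<open>Convex combinations of points in a ball\<close>

text \<open>The second moment about the mean \<open>z\<close> is smaller by \<open>(norm (z - c))\<^sup>2\<close> than the second moment
  about \<open>c\<close>, and the latter is a weighted mean of numbers that do not exceed \<open>\<rho>\<^sup>2\<close>.\<close>

lemma weighted_sq_dist_le_ball:
  fixes V :: "'a::euclidean_space set"
  assumes "\<And>v. v \<in> V \<Longrightarrow> 0 \<le> w v" "sum w V = 1" "(\<Sum>v\<in>V. w v *\<^sub>R v) = z"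
    and "V \<subseteq> cball c \<rho>"
  shows "(\<Sum>v\<in>V. w v * (norm (v - z))\<^sup>2) \<le> \<rho>\<^sup>2"
proof -
  have expand: "w v * (norm (v - z))\<^sup>2 =
      w v * (norm (v - c))\<^sup>2 - 2 * ((w v *\<^sub>R v) \<bullet> (z - c)) + w v * (2 * (c \<bullet> (z - c)) + (norm (z - c))\<^sup>2)" for v
    by (simp add: power2_norm_eq_inner inner_diff_left inner_diff_right inner_commute algebra_simps)
  have "(\<Sum>v\<in>V. (w v *\<^sub>R v) \<bullet> (z - c)) = z \<bullet> (z - c)"
    unfolding inner_sum_left[symmetric] assms(3) ..
  then have "(\<Sum>v\<in>V. w v * (norm (v - z))\<^sup>2) =
      (\<Sum>v\<in>V. w v * (norm (v - c))\<^sup>2) - 2 * (z \<bullet> (z - c)) + (2 * (c \<bullet> (z - c)) + (norm (z - c))\<^sup>2)"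
    unfolding expand sum.distrib sum_subtractf
    by (simp add: assms(2) del: inner_scaleR_left flip: sum_distrib_left sum_distrib_right)
  also have "\<dots> = (\<Sum>v\<in>V. w v * (norm (v - c))\<^sup>2) - (norm (z - c))\<^sup>2"
    by (simp add: power2_norm_eq_inner inner_diff_left inner_diff_right inner_commute algebra_simps)
  also have "\<dots> \<le> (\<Sum>v\<in>V. w v * (norm (v - c))\<^sup>2)"
    by simp
  also have "\<dots> \<le> (\<Sum>v\<in>V. w v * \<rho>\<^sup>2)"
  proof (rule sum_mono)
    fix v assume "v \<in> V"
    then have "norm (v - c) \<le> \<rho>"
      using assms(4) by (auto simp: dist_norm norm_minus_commute)
    then show "w v * (norm (v - c))\<^sup>2 \<le> w v * \<rho>\<^sup>2"
      using assms(1)[OF \<open>v \<in> V\<close>] by (intro mult_left_mono power_mono) auto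
  qed
  also have "\<dots> = \<rho>\<^sup>2"
    by (simp add: assms(2) flip: sum_distrib_right)
  finally show ?thesis .
qed

text \<open>Boundedness makes the set of admissible radii nonempty; otherwise its infimum would be
  unspecified.\<close>

lemma min_ball_radius_greatest:
  assumes "bounded S" "\<And>c \<rho>. S \<subseteq> cball c \<rho> \<Longrightarrow> x \<le> \<rho>"
  shows "x \<le> min_ball_radius S"
  unfolding min_ball_radius_def
proof (rule cInf_greatest)
  show "{\<rho>. \<exists>c. S \<subseteq> cball c \<rho>} \<noteq> {}"
    using assms(1) by (auto simp: bounded_subset_cball)
qed (use assms(2) in auto)

lemma min_ball_radius_nonneg:
  assumes "bounded S" "S \<noteq> {}"
  shows "0 \<le> min_ball_radius S"
proof (rule min_ball_radius_greatest[OF assms(1)])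
  fix c \<rho> assume "S \<subseteq> cball c \<rho>"
  then have "cball c \<rho> \<noteq> {}" using assms(2) by blast
  then show "0 \<le> \<rho>" by simp
qed

text \<open>The estimate holds for each ball that contains \<open>S\<close>, so it survives the infimum over the radii.\<close>

lemma weighted_sq_dist_le_min_ball_radius:
  fixes V :: "'a::euclidean_space set"
  assumes w: "\<And>v. v \<in> V \<Longrightarrow> 0 \<le> w v" "sum w V = 1" "(\<Sum>v\<in>V. w v *\<^sub>R v) = z"
    and S: "V \<subseteq> S" "bounded S"
  shows "(\<Sum>v\<in>V. w v * (norm (v - z))\<^sup>2) \<le> (min_ball_radius S)\<^sup>2"
proof -
  have "S \<noteq> {}" using w(2) S(1) by auto
  have "sqrt (\<Sum>v\<in>V. w v * (norm (v - z))\<^sup>2) \<le> min_ball_radius S"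
  proof (rule min_ball_radius_greatest[OF S(2)])
    fix c \<rho> assume S': "S \<subseteq> cball c \<rho>"
    then have "cball c \<rho> \<noteq> {}" using \<open>S \<noteq> {}\<close> by blast
    then have "0 \<le> \<rho>" by simp
    moreover have "V \<subseteq> cball c \<rho>" using S(1) S' by blast
    ultimately show "sqrt (\<Sum>v\<in>V. w v * (norm (v - z))\<^sup>2) \<le> \<rho>"
      using weighted_sq_dist_le_ball[OF w] by (simp add: real_le_lsqrt)
  qed
  then show ?thesis
    by (rule sqrt_le_D)
qed

section \<open>Interpolation error of Lipschitz and of twice differentiable functions\<close>

text \<open>The error is at most \<open>L\<close> times the weighted mean \<open>m\<close> of the distances from \<open>z\<close>. The variance of
  the distances is nonnegative, so \<open>m\<^sup>2\<close> is at most the mean of their squares.\<close>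

lemma interpolation_error_linear_growth:
  fixes g :: "'a::euclidean_space \<Rightarrow> real"
  assumes w: "\<And>v. v \<in> V \<Longrightarrow> 0 \<le> w v" "sum w V = 1"
    and var: "(\<Sum>v\<in>V. w v * (norm (v - z))\<^sup>2) \<le> \<rho>\<^sup>2" and "0 \<le> \<rho>" "0 \<le> L"
    and g: "\<And>v. v \<in> V \<Longrightarrow> \<bar>g v - g z\<bar> \<le> L * norm (v - z)"
  shows "\<bar>(\<Sum>v\<in>V. w v * g v) - g z\<bar> \<le> L * \<rho>"
proof -
  define m where "m = (\<Sum>v\<in>V. w v * norm (v - z))"
  have "0 \<le> (\<Sum>v\<in>V. w v * (norm (v - z) - m)\<^sup>2)"
    using w(1) by (intro sum_nonneg) simp
  also have "\<dots> = (\<Sum>v\<in>V. w v * (norm (v - z))\<^sup>2 - 2 * m * (w v * norm (v - z)) + w v * m\<^sup>2)"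
    by (intro sum.cong refl) (simp add: power2_eq_square algebra_simps)
  also have "\<dots> = (\<Sum>v\<in>V. w v * (norm (v - z))\<^sup>2) - m\<^sup>2"
    unfolding sum.distrib sum_subtractf
    by (simp add: w(2) power2_eq_square m_def[symmetric] flip: sum_distrib_left sum_distrib_right)
  finally have "m\<^sup>2 \<le> \<rho>\<^sup>2"
    using var by simp
  then have "m \<le> \<rho>"
    using \<open>0 \<le> \<rho>\<close> by (rule power2_le_imp_le)
  have "(\<Sum>v\<in>V. w v * g v) - g z = (\<Sum>v\<in>V. w v * (g v - g z))"
    by (simp add: right_diff_distrib sum_subtractf w(2) flip: sum_distrib_right)
  also have "\<bar>\<dots>\<bar> \<le> (\<Sum>v\<in>V. w v * (L * norm (v - z)))"
    using w(1) g by (intro order.trans[OF sum_abs] sum_mono) (simp add: abs_mult mult_left_mono)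
  also have "\<dots> = L * m"
    unfolding m_def sum_distrib_left by (intro sum.cong) simp_all
  also have "\<dots> \<le> L * \<rho>"
    using \<open>m \<le> \<rho>\<close> \<open>0 \<le> L\<close> by (rule mult_left_mono)
  finally show ?thesis .
qed

text \<open>Since \<open>z\<close> is the weighted mean of the \<open>v\<close>, the linear terms \<open>y \<bullet> (v - z)\<close> have weighted sum
  \<open>0\<close>, and only the quadratic remainders contribute.\<close>

lemma interpolation_error_quadratic_growth:
  fixes g :: "'a::euclidean_space \<Rightarrow> real"
  assumes w: "\<And>v. v \<in> V \<Longrightarrow> 0 \<le> w v" "sum w V = 1" "(\<Sum>v\<in>V. w v *\<^sub>R v) = z"
    and var: "(\<Sum>v\<in>V. w v * (norm (v - z))\<^sup>2) \<le> \<rho>\<^sup>2" and "0 \<le> M"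
    and g: "\<And>v. v \<in> V \<Longrightarrow> \<bar>g v - g z - y \<bullet> (v - z)\<bar> \<le> M / 2 * (norm (v - z))\<^sup>2"
  shows "\<bar>(\<Sum>v\<in>V. w v * g v) - g z\<bar> \<le> 1 / 2 * \<rho>\<^sup>2 * M"
proof -
  have "(\<Sum>v\<in>V. w v * (y \<bullet> (v - z))) = y \<bullet> ((\<Sum>v\<in>V. w v *\<^sub>R v) - sum w V *\<^sub>R z)"
    by (simp add: inner_sum_right inner_diff_right sum_subtractf scaleR_left.sum right_diff_distrib)
  then have "(\<Sum>v\<in>V. w v * (y \<bullet> (v - z))) = 0"
    using w(2,3) by simp
  then have "(\<Sum>v\<in>V. w v * g v) - g z = (\<Sum>v\<in>V. w v * (g v - g z - y \<bullet> (v - z)))"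
    by (simp add: right_diff_distrib sum_subtractf w(2) flip: sum_distrib_right)
  also have "\<bar>\<dots>\<bar> \<le> (\<Sum>v\<in>V. w v * (M / 2 * (norm (v - z))\<^sup>2))"
    using w(1) by (intro order.trans[OF sum_abs] sum_mono) (simp add: abs_mult mult_left_mono[OF g] del: times_divide_eq_left)
  also have "\<dots> = M / 2 * (\<Sum>v\<in>V. w v * (norm (v - z))\<^sup>2)"
    unfolding sum_distrib_left by (intro sum.cong) simp_all
  also have "\<dots> \<le> M / 2 * \<rho>\<^sup>2"
    using var \<open>0 \<le> M\<close> by (intro mult_left_mono) simp_all
  finally show ?thesis
    by (simp add: mult.commute)
qed

section \<open>Growth estimates from Lipschitz constant, gradient and Hessian\<close>

text \<open>The infimum of all Lipschitz constants is attained, because each of them bounds every difference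
  quotient.\<close>

lemma lipschitz_on_lipschitz_const:
  assumes "L-lipschitz_on X g"
  shows "(lipschitz_const X g)-lipschitz_on X g"
proof (rule lipschitz_onI)
  have ne: "{L. L-lipschitz_on X g} \<noteq> {}"
    using assms by blast
  show "0 \<le> lipschitz_const X g"
    unfolding lipschitz_const_def using ne by (rule cInf_greatest) (auto dest: lipschitz_on_nonneg)
  show "dist (g x) (g y) \<le> lipschitz_const X g * dist x y" if "x \<in> X" "y \<in> X" for x y
  proof (cases "x = y")
    case False
    have "dist (g x) (g y) / dist x y \<le> lipschitz_const X g"
      unfolding lipschitz_const_def using ne
    proof (rule cInf_greatest)
      fix K assume "K \<in> {L. L-lipschitz_on X g}"
      then show "dist (g x) (g y) / dist x y \<le> K"
        using False that by (auto simp: divide_le_eq dest: lipschitz_onD)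
    qed
    then show ?thesis
      using False by (simp add: divide_le_eq)
  qed simp
qed

lemma norm_le_SUP_norm:
  fixes F :: "'a::topological_space \<Rightarrow> 'b::real_normed_vector"
  assumes "compact X" "continuous_on X F" "s \<in> X"
  shows "norm (F s) \<le> (SUP s\<in>X. norm (F s))"
proof (rule cSUP_upper[OF assms(3)])
  show "bdd_above ((\<lambda>s. norm (F s)) ` X)"
    using assms(1,2)
    by (intro bounded_imp_bdd_above compact_imp_bounded compact_continuous_image continuous_intros)
qed

text \<open>The mean value inequality applies in the convex interior, and a Lipschitz estimate extends to the
  closure by continuity.\<close>

lemma gradient_bound_imp_lipschitz:
  fixes X :: "'a::euclidean_space set"
  assumes X: "convex X" "closed X" "X \<subseteq> closure (interior X)" and G: "C1_gradient_on X g G"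
    and B: "\<And>s. s \<in> X \<Longrightarrow> norm (G s) \<le> B" "0 \<le> B"
  shows "B-lipschitz_on X g"
proof -
  have "B-lipschitz_on (interior X) g"
  proof (rule lipschitz_onI[OF _ B(2)])
    fix x y assume xy: "x \<in> interior X" "y \<in> interior X"
    have "norm (g x - g y) \<le> B * norm (x - y)"
    proof (rule differentiable_bound[OF convex_interior[OF X(1)] _ _ xy])
      fix s assume s: "s \<in> interior X"
      show "(g has_derivative (\<lambda>v. G s \<bullet> v)) (at s within interior X)"
        using G s unfolding C1_gradient_on_def by (blast intro: has_derivative_at_withinI)
      have "norm (G s) \<le> B"
        using s interior_subset B(1) by blast
      then show "onorm (\<lambda>v. G s \<bullet> v) \<le> B"
        by (intro onorm_le) (metis Cauchy_Schwarz_ineq2 real_norm_def mult_right_mono norm_ge_zero order.trans)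
    qed
    then show "dist (g x) (g y) \<le> B * dist x y"
      by (simp add: dist_norm)
  qed
  moreover have "closure (interior X) = X"
    using X(2,3) closure_minimal[OF interior_subset] by blast
  ultimately show ?thesis
    using lipschitz_on_closure[of B "interior X" g] G by (simp add: C1_gradient_on_def)
qed

text \<open>Along the segment \<open>x + t *\<^sub>R d\<close> the remainder of \<open>g\<close> has derivative
  \<open>(G (x + t *\<^sub>R d) - G x) \<bullet> d\<close>, of absolute value at most \<open>M * (norm d)\<^sup>2 * t\<close>; integrating over
  \<open>t \<in> {0..1}\<close> yields the factor \<open>1 / 2\<close>.\<close>

lemma taylor_remainder_lipschitz_gradient:
  fixes g :: "'a::euclidean_space \<Rightarrow> real"
  assumes "convex U"
    and g: "\<And>s. s \<in> U \<Longrightarrow> (g has_derivative (\<lambda>v. G s \<bullet> v)) (at s)"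
    and G: "M-lipschitz_on U G"
    and xy: "x \<in> U" "y \<in> U"
  shows "\<bar>g y - g x - G x \<bullet> (y - x)\<bar> \<le> M / 2 * (norm (y - x))\<^sup>2"
proof -
  define d where "d = y - x"
  have seg: "x + t *\<^sub>R d \<in> U" if "0 \<le> t" "t \<le> 1" for t
    using convexD_alt[OF assms(1) xy that] by (simp add: d_def algebra_simps)
  have "norm ((g (x + 1 *\<^sub>R d) - 1 * (G x \<bullet> d)) - (g (x + 0 *\<^sub>R d) - 0 * (G x \<bullet> d)))
      \<le> (\<lambda>t. M / 2 * (norm d)\<^sup>2 * t\<^sup>2) 1 - (\<lambda>t. M / 2 * (norm d)\<^sup>2 * t\<^sup>2) 0"
  proof (rule differentiable_bound_general[where f = "\<lambda>t. g (x + t *\<^sub>R d) - t * (G x \<bullet> d)"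
        and f' = "\<lambda>t. (G (x + t *\<^sub>R d) - G x) \<bullet> d" and \<phi>' = "\<lambda>t. M * (norm d)\<^sup>2 * t"])
    have der: "((\<lambda>t. g (x + t *\<^sub>R d) - t * (G x \<bullet> d)) has_vector_derivative
        (G (x + t *\<^sub>R d) - G x) \<bullet> d) (at t)" if "0 \<le> t" "t \<le> 1" for t
    proof -
      have "((\<lambda>t. x + t *\<^sub>R d) has_derivative (\<lambda>s. s *\<^sub>R d)) (at t)"
        by (auto intro!: derivative_eq_intros)
      from diff_chain_at[OF this g[OF seg[OF that]]]
      have "((\<lambda>t. g (x + t *\<^sub>R d)) has_derivative (\<lambda>s. G (x + t *\<^sub>R d) \<bullet> (s *\<^sub>R d))) (at t)"
        by (simp add: o_def)
      then show ?thesis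
        unfolding has_vector_derivative_def
        by (auto intro!: derivative_eq_intros simp: inner_diff_left algebra_simps)
    qed
    show "continuous_on {0..1} (\<lambda>t. g (x + t *\<^sub>R d) - t * (G x \<bullet> d))"
      by (intro continuous_at_imp_continuous_on ballI has_vector_derivative_continuous[OF der]) auto
    show "((\<lambda>t. g (x + t *\<^sub>R d) - t * (G x \<bullet> d)) has_vector_derivative
        (G (x + t *\<^sub>R d) - G x) \<bullet> d) (at t)" if "0 < t" "t < 1" for t
      using der that by simp
    show "((\<lambda>t. M / 2 * (norm d)\<^sup>2 * t\<^sup>2) has_vector_derivative M * (norm d)\<^sup>2 * t) (at t)" for t
      unfolding has_real_derivative_iff_has_vector_derivative[symmetric]
      by (auto intro!: derivative_eq_intros)
    show "norm ((G (x + t *\<^sub>R d) - G x) \<bullet> d) \<le> M * (norm d)\<^sup>2 * t" if "0 < t" "t < 1" for t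
    proof -
      have "norm (G (x + t *\<^sub>R d) - G x) \<le> M * (t * norm d)"
        using lipschitz_onD[OF G seg[of t] xy(1)] that by (simp add: dist_norm)
      then have "norm (G (x + t *\<^sub>R d) - G x) * norm d \<le> M * (t * norm d) * norm d"
        by (rule mult_right_mono) simp
      then show ?thesis
        using Cauchy_Schwarz_ineq2[of "G (x + t *\<^sub>R d) - G x" d]
        by (simp add: power2_eq_square algebra_simps)
    qed
  qed (auto intro!: continuous_intros)
  then show ?thesis
    by (simp add: d_def algebra_simps)
qed

text \<open>In the interior the bound on the Hessian makes the gradient Lipschitz. Both sides of the Taylor
  estimate are continuous in \<open>x\<close> and \<open>y\<close>, so points of \<open>X\<close> are handled by approximating them from
  the interior.\<close>

lemma hessian_bound_imp_taylor_remainder: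
  fixes X :: "'a::euclidean_space set"
  assumes X: "convex X" "X \<subseteq> closure (interior X)" and H: "C2_hessian_on X g H"
    and M: "\<And>s. s \<in> X \<Longrightarrow> norm (H s) \<le> M" "0 \<le> M"
  obtains G where
    "\<And>x y. x \<in> X \<Longrightarrow> y \<in> X \<Longrightarrow> \<bar>g y - g x - G x \<bullet> (y - x)\<bar> \<le> M / 2 * (norm (y - x))\<^sup>2"
proof -
  obtain G where G: "C1_gradient_on X g G"
      "\<And>s. s \<in> interior X \<Longrightarrow> (G has_derivative blinfun_apply (H s)) (at s)"
    using H by (auto simp: C2_hessian_on_def)
  have cont: "continuous_on X g" "continuous_on X G"
    and der: "\<And>s. s \<in> interior X \<Longrightarrow> (g has_derivative (\<lambda>v. G s \<bullet> v)) (at s)"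
    using G(1) by (auto simp: C1_gradient_on_def)
  have "M-lipschitz_on (interior X) G"
  proof (rule lipschitz_onI[OF _ M(2)])
    fix x y assume xy: "x \<in> interior X" "y \<in> interior X"
    have "norm (G x - G y) \<le> M * norm (x - y)"
    proof (rule differentiable_bound[OF convex_interior[OF X(1)] _ _ xy])
      fix s assume s: "s \<in> interior X"
      then show "(G has_derivative blinfun_apply (H s)) (at s within interior X)"
        using G(2) by (blast intro: has_derivative_at_withinI)
      show "onorm (blinfun_apply (H s)) \<le> M"
        using M(1)[of s] s interior_subset unfolding norm_blinfun.rep_eq by blast
    qed
    then show "dist (G x) (G y) \<le> M * dist x y"
      by (simp add: dist_norm)
  qed
  note interior_bound =
    taylor_remainder_lipschitz_gradient[OF convex_interior[OF X(1)] der this]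
  have "\<bar>g y - g x - G x \<bullet> (y - x)\<bar> \<le> M / 2 * (norm (y - x))\<^sup>2" if xy: "x \<in> X" "y \<in> X" for x y
  proof -
    obtain p where p: "\<And>n. p n \<in> interior X" "p \<longlonglongrightarrow> x"
      using subsetD[OF X(2) xy(1)] unfolding closure_sequential by blast
    obtain q where q: "\<And>n. q n \<in> interior X" "q \<longlonglongrightarrow> y"
      using subsetD[OF X(2) xy(2)] unfolding closure_sequential by blast
    have pq: "\<And>n. p n \<in> X" "\<And>n. q n \<in> X"
      using p(1) q(1) interior_subset by blast+
    have lim: "(\<lambda>n. g (p n)) \<longlonglongrightarrow> g x" "(\<lambda>n. g (q n)) \<longlonglongrightarrow> g y" "(\<lambda>n. G (p n)) \<longlonglongrightarrow> G x"
      using cont p(2) q(2) pq xy unfolding continuous_on_sequentially o_def by blast+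
    show ?thesis
    proof (rule LIMSEQ_le)
      show "(\<lambda>n. \<bar>g (q n) - g (p n) - G (p n) \<bullet> (q n - p n)\<bar>) \<longlonglongrightarrow> \<bar>g y - g x - G x \<bullet> (y - x)\<bar>"
        by (intro tendsto_intros lim p(2) q(2))
      show "(\<lambda>n. M / 2 * (norm (q n - p n))\<^sup>2) \<longlonglongrightarrow> M / 2 * (norm (y - x))\<^sup>2"
        by (intro tendsto_intros p(2) q(2))
    qed (use interior_bound p(1) q(1) in blast)
  qed
  then show ?thesis
    by (rule that)
qed

text \<open>Needed because \<open>Min\<close> is meaningful only for finite sets: gradient and Hessian are unique on \<open>X\<close>,
  so each smoothness class contributes at most one bound, whatever values the witnesses take outside
  of \<open>X\<close>.\<close>

lemma finite_applicable_bounds: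
  assumes "X \<subseteq> closure (interior X)"
  shows "finite (applicable_bounds X \<delta> g)"
proof -
  have "finite {\<delta> * (SUP s\<in>X. norm (G s)) | G. C1_gradient_on X g G}" (is "finite ?A")
  proof (rule finite_subset)
    show "?A \<subseteq> {\<delta> * (SUP s\<in>X. norm ((SOME G. C1_gradient_on X g G) s))}"
    proof
      fix e assume "e \<in> ?A"
      then obtain G where G: "e = \<delta> * (SUP s\<in>X. norm (G s))" "C1_gradient_on X g G"
        by blast
      have "G s = (SOME G. C1_gradient_on X g G) s" if "s \<in> X" for s
        by (rule C1_gradient_on_unique[OF G(2) someI[of "C1_gradient_on X g", OF G(2)] assms that])
      then show "e \<in> {\<delta> * (SUP s\<in>X. norm ((SOME G. C1_gradient_on X g G) s))}"
        using G(1) by simp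
    qed
  qed simp
  moreover have "finite {1 / 2 * \<delta>\<^sup>2 * (SUP s\<in>X. norm (H s)) | H. C2_hessian_on X g H}" (is "finite ?B")
  proof (rule finite_subset)
    show "?B \<subseteq> {1 / 2 * \<delta>\<^sup>2 * (SUP s\<in>X. norm ((SOME H. C2_hessian_on X g H) s))}"
    proof
      fix e assume "e \<in> ?B"
      then obtain H where H: "e = 1 / 2 * \<delta>\<^sup>2 * (SUP s\<in>X. norm (H s))" "C2_hessian_on X g H"
        by blast
      have "H s = (SOME H. C2_hessian_on X g H) s" if "s \<in> X" for s
        by (rule C2_hessian_on_unique[OF H(2) someI[of "C2_hessian_on X g", OF H(2)] assms that])
      then show "e \<in> {1 / 2 * \<delta>\<^sup>2 * (SUP s\<in>X. norm ((SOME H. C2_hessian_on X g H) s))}"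
        using H(1) by simp
    qed
  qed simp
  ultimately show ?thesis
    by (simp add: applicable_bounds_def)
qed

lemma interpolation_error_le_applicable_bound:
  fixes X :: "'a::euclidean_space set"
  assumes X: "convex X" "compact X" "X \<subseteq> closure (interior X)"
    and lip: "\<exists>L. L-lipschitz_on X g"
    and w: "\<And>v. v \<in> V \<Longrightarrow> 0 \<le> w v" "sum w V = 1" "(\<Sum>v\<in>V. w v *\<^sub>R v) = z"
    and V: "V \<subseteq> X" "z \<in> X"
    and var: "(\<Sum>v\<in>V. w v * (norm (v - z))\<^sup>2) \<le> \<delta>\<^sup>2" and \<delta>: "0 \<le> \<delta>"
    and e: "e \<in> applicable_bounds X \<delta> g"
  shows "\<bar>(\<Sum>v\<in>V. w v * g v) - g z\<bar> \<le> e"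
proof -
  have lipschitz: "\<bar>(\<Sum>v\<in>V. w v * g v) - g z\<bar> \<le> L * \<delta>" if L: "L-lipschitz_on X g" for L
  proof (rule interpolation_error_linear_growth[OF w(1,2) var \<delta> lipschitz_on_nonneg[OF L]])
    show "\<bar>g v - g z\<bar> \<le> L * norm (v - z)" if "v \<in> V" for v
      using lipschitz_onD[OF L, of v z] that V by (auto simp: dist_norm)
  qed
  obtain L where "L-lipschitz_on X g"
    using lip by blast
  note const = lipschitz_on_lipschitz_const[OF this]
  consider "e = 2 * lipschitz_const X g * \<delta>" | "e = lipschitz_const X g * \<delta>"
    | G where "e = \<delta> * (SUP s\<in>X. norm (G s))" "C1_gradient_on X g G"
    | H where "e = 1 / 2 * \<delta>\<^sup>2 * (SUP s\<in>X. norm (H s))" "C2_hessian_on X g H"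
    using e unfolding applicable_bounds_def by (auto split: if_splits)
  then show ?thesis
  proof cases
    case 1
    moreover have "0 \<le> lipschitz_const X g * \<delta>"
      using lipschitz_on_nonneg[OF const] \<delta> by simp
    ultimately show ?thesis
      using lipschitz[OF const] by simp
  next
    case 2
    then show ?thesis
      using lipschitz[OF const] by simp
  next
    case (3 G)
    have G: "norm (G s) \<le> (SUP s\<in>X. norm (G s))" if "s \<in> X" for s
      using 3(2) that by (intro norm_le_SUP_norm[OF X(2)]) (auto simp: C1_gradient_on_def)
    moreover have "0 \<le> (SUP s\<in>X. norm (G s))"
      using G[OF V(2)] norm_ge_zero order.trans by blast
    ultimately have "(SUP s\<in>X. norm (G s))-lipschitz_on X g"
      by (rule gradient_bound_imp_lipschitz[OF X(1) compact_imp_closed[OF X(2)] X(3) 3(2)])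
    then show ?thesis
      unfolding 3(1) by (subst mult.commute) (rule lipschitz)
  next
    case (4 H)
    have H: "norm (H s) \<le> (SUP s\<in>X. norm (H s))" if "s \<in> X" for s
      using 4(2) that by (intro norm_le_SUP_norm[OF X(2)]) (auto simp: C2_hessian_on_def)
    have nonneg: "0 \<le> (SUP s\<in>X. norm (H s))"
      using H[OF V(2)] norm_ge_zero order.trans by blast
    obtain G where G: "\<And>x y. x \<in> X \<Longrightarrow> y \<in> X \<Longrightarrow>
        \<bar>g y - g x - G x \<bullet> (y - x)\<bar> \<le> (SUP s\<in>X. norm (H s)) / 2 * (norm (y - x))\<^sup>2"
      using hessian_bound_imp_taylor_remainder[OF X(1,3) 4(2) H nonneg] by blast
    show ?thesis
      unfolding 4(1) using G V
      by (intro interpolation_error_quadratic_growth[OF w var nonneg, where y = "G z"]) blast+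
  qed
qed

section \<open>The simplices of a uniform mesh\<close>

lemma element_simplex_subset_element:
  assumes h: "\<And>i. i \<in> Basis \<Longrightarrow> 0 < h \<bullet> i" and js: "set js = Basis"
  shows "element_simplex c h js \<subseteq> cbox c (c + h)"
proof
  fix z assume "z \<in> element_simplex c h js"
  then have z: "0 \<le> (z \<bullet> i - c \<bullet> i) / (h \<bullet> i) \<and> (z \<bullet> i - c \<bullet> i) / (h \<bullet> i) \<le> 1" if "i \<in> Basis" for i
    using that js by (auto simp: element_simplex_def sorted_append)
  have "c \<bullet> i \<le> z \<bullet> i \<and> z \<bullet> i \<le> c \<bullet> i + h \<bullet> i" if "i \<in> Basis" for i
    using z[OF that] h[OF that] by (simp add: zero_le_divide_iff divide_le_eq)
  then show "z \<in> cbox c (c + h)"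
    by (simp add: mem_box inner_add_left)
qed

text \<open>This is the decomposition behind the simplices. Let \<open>t\<^sub>1 \<le> \<dots> \<le> t\<^sub>N\<close> be the relative
  coordinates of \<open>z\<close> in the order of \<open>js\<close>, and put \<open>t\<^sub>0 = 0\<close> and \<open>t\<^sub>N\<^sub>+\<^sub>1 = 1\<close>. The vertices of the
  simplex are the corners \<open>v k\<close> whose first \<open>k\<close> relative coordinates are \<open>0\<close> and the others \<open>1\<close>;
  with the increments \<open>t\<^sub>k\<^sub>+\<^sub>1 - t\<^sub>k\<close> as weights, the sum telescopes in every coordinate to that of
  \<open>z\<close>.\<close>

lemma element_simplex_subset_convex_hull:
  fixes c h :: "'a::euclidean_space"
  assumes h: "\<And>i. i \<in> Basis \<Longrightarrow> 0 < h \<bullet> i" and js: "distinct js" "set js = Basis"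
  shows "element_simplex c h js \<subseteq> convex hull (element_simplex c h js \<inter> corner_points c (c + h))"
proof
  fix z assume z: "z \<in> element_simplex c h js"
  define N where "N = length js"
  \<comment> \<open>The bounds 0 and 1 are part of the list, so that \<open>s ! Suc l\<close> belongs to the coordinate \<open>js ! l\<close>.\<close>
  define s where "s = 0 # map (\<lambda>i. (z \<bullet> i - c \<bullet> i) / (h \<bullet> i)) js @ [1]"
  define w where "w k = s ! Suc k - s ! k" for k
  define v where "v k = c + (\<Sum>i\<in>set (drop k js). (h \<bullet> i) *\<^sub>R i)" for k
  have v_inner: "v k \<bullet> i = c \<bullet> i + (if i \<in> set (drop k js) then h \<bullet> i else 0)" if "i \<in> Basis" for k i
  proof -
    have "(\<Sum>j\<in>set (drop k js). (h \<bullet> j) *\<^sub>R j) \<bullet> i = (\<Sum>j\<in>set (drop k js). if j = i then h \<bullet> i else 0)"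
      unfolding inner_sum_left using that js(2) set_drop_subset[of k js]
      by (intro sum.cong) (auto simp: inner_Basis)
    then show ?thesis
      by (simp add: v_def inner_add_left)
  qed
  have mem_drop: "js ! l \<in> set (drop k js) \<longleftrightarrow> k \<le> l" if "l < N" for l k
  proof
    assume "js ! l \<in> set (drop k js)"
    then obtain m where m: "m < N - k" "js ! l = js ! (k + m)"
      by (auto simp: in_set_conv_nth N_def)
    then have "l = k + m"
      using nth_eq_iff_index_eq[OF js(1), of l "k + m"] that by (simp add: N_def)
    then show "k \<le> l" by simp
  next
    assume "k \<le> l"
    then show "js ! l \<in> set (drop k js)"
      using that by (auto simp: in_set_conv_nth N_def intro!: exI[of _ "l - k"])
  qed
  have v_mem: "v k \<in> element_simplex c h js \<inter> corner_points c (c + h)" for k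
  proof
    show "v k \<in> corner_points c (c + h)"
      using v_inner by (auto simp: corner_points_def inner_add_left)
    have "map (\<lambda>i. (v k \<bullet> i - c \<bullet> i) / (h \<bullet> i)) js = map (\<lambda>l. if k \<le> l then 1 else 0) [0..<N]"
    proof (rule nth_equalityI)
      fix l assume "l < length (map (\<lambda>i. (v k \<bullet> i - c \<bullet> i) / (h \<bullet> i)) js)"
      then have l: "l < N" by (simp add: N_def)
      then have "js ! l \<in> Basis"
        unfolding js(2)[symmetric] N_def by (rule nth_mem)
      from v_inner[OF this, of k] h[OF this] l
      show "map (\<lambda>i. (v k \<bullet> i - c \<bullet> i) / (h \<bullet> i)) js ! l = map (\<lambda>l. if k \<le> l then 1 else 0) [0..<N] ! l"
        by (simp add: mem_drop N_def)
    qed (simp add: N_def)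
    moreover have "sorted (map (\<lambda>l. if k \<le> l then 1 else (0::real)) [0..<N])"
      by (auto simp: sorted_iff_nth_mono)
    ultimately show "v k \<in> element_simplex c h js"
      unfolding element_simplex_def mem_Collect_eq by (auto simp: sorted_append)
  qed
  have "sorted s"
    using z by (simp add: element_simplex_def s_def)
  moreover have "length s = Suc (Suc N)"
    by (simp add: s_def N_def)
  ultimately have w_nonneg: "0 \<le> w k" if "k \<le> N" for k
    using that by (auto simp: w_def intro!: sorted_nth_mono)
  have w_sum: "(\<Sum>k\<le>l. w k) = s ! Suc l" for l
    using sum_telescope[of "\<lambda>k. - (s ! k)" l] by (simp add: w_def s_def)
  have w_one: "(\<Sum>k\<le>N. w k) = 1"
    unfolding w_sum by (simp add: s_def nth_append N_def)
  have "(\<Sum>k\<le>N. w k *\<^sub>R v k) = z"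
  proof (rule euclidean_eqI)
    fix i :: 'a assume i: "i \<in> Basis"
    then obtain l where l: "l < N" "i = js ! l"
      using js(2) by (metis in_set_conv_nth N_def)
    have "(\<Sum>k\<le>N. w k *\<^sub>R v k) \<bullet> i = (\<Sum>k\<le>N. w k * (c \<bullet> i) + (if k \<le> l then w k * (h \<bullet> i) else 0))"
      unfolding inner_sum_left using v_inner[OF i] l
      by (intro sum.cong refl) (simp add: mem_drop algebra_simps)
    also have "\<dots> = c \<bullet> i + (\<Sum>k\<le>N. if k \<le> l then w k * (h \<bullet> i) else 0)"
      by (simp add: sum.distrib w_one flip: sum_distrib_right)
    also have "(\<Sum>k\<le>N. if k \<le> l then w k * (h \<bullet> i) else 0) = (\<Sum>k\<le>l. w k * (h \<bullet> i))"
      using l(1) by (intro sum.mono_neutral_cong_right) auto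
    also have "\<dots> = s ! Suc l * (h \<bullet> i)"
      by (simp add: w_sum flip: sum_distrib_right)
    also have "s ! Suc l = (z \<bullet> i - c \<bullet> i) / (h \<bullet> i)"
      using l by (simp add: s_def nth_append N_def)
    finally show "(\<Sum>k\<le>N. w k *\<^sub>R v k) \<bullet> i = z \<bullet> i"
      using h[OF i] by simp
  qed
  moreover have "(\<Sum>k\<le>N. w k *\<^sub>R v k) \<in> convex hull (element_simplex c h js \<inter> corner_points c (c + h))"
    using w_one w_nonneg hull_inc[OF v_mem] by (intro convex_sum) auto
  ultimately show "z \<in> convex hull (element_simplex c h js \<inter> corner_points c (c + h))"
    by simp
qed

text \<open>Sorting the coordinates of \<open>z\<close> gives the permutation.\<close>

lemma element_covered_by_simplices:
  fixes c h :: "'a::euclidean_space"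
  assumes h: "\<And>i. i \<in> Basis \<Longrightarrow> 0 < h \<bullet> i" and z: "z \<in> cbox c (c + h)"
  obtains js where "distinct js" "set js = Basis" "z \<in> element_simplex c h js"
proof -
  obtain bs :: "'a list" where bs: "set bs = Basis" "distinct bs"
    using finite_distinct_list[OF finite_Basis] by blast
  define t where "t i = (z \<bullet> i - c \<bullet> i) / (h \<bullet> i)" for i
  have t: "0 \<le> t i \<and> t i \<le> 1" if "i \<in> Basis" for i
    using h[OF that] z that by (auto simp: t_def mem_box inner_add_left divide_le_eq add.commute diff_le_eq)
  have "z \<in> element_simplex c h (sort_key t bs)"
    using t bs(1) by (auto simp: element_simplex_def sorted_append simp flip: t_def)
  then show ?thesis
    using that[of "sort_key t bs"] bs by simp
qed

lemma mesh_step_pos: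
  assumes "\<forall>i\<in>Basis. a \<bullet> i < b \<bullet> i" "r \<ge> 2" "i \<in> Basis"
  shows "0 < mesh_step a b r \<bullet> i"
  using assms by (simp add: mesh_step_def inner_diff_left)

lemma mesh_step_total:
  assumes "r \<ge> 2"
  shows "(real r - 1) * (mesh_step a b r \<bullet> i) = b \<bullet> i - a \<bullet> i"
  using assms by (simp add: mesh_step_def inner_diff_left)

lemma grid_points_subset_cbox:
  assumes ab: "\<forall>i\<in>Basis. a \<bullet> i < b \<bullet> i" and r: "r \<ge> 2"
  shows "grid_points a b r \<subseteq> cbox a b"
proof
  fix z assume z: "z \<in> grid_points a b r"
  have "a \<bullet> i \<le> z \<bullet> i \<and> z \<bullet> i \<le> b \<bullet> i" if i: "i \<in> Basis" for i
  proof -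
    obtain k where k: "k < r" "z \<bullet> i = a \<bullet> i + real k * (mesh_step a b r \<bullet> i)"
      using z i by (auto simp: grid_points_def)
    have "real k * (mesh_step a b r \<bullet> i) \<le> (real r - 1) * (mesh_step a b r \<bullet> i)"
      using k(1) mesh_step_pos[OF ab r i] by (intro mult_right_mono) auto
    then show ?thesis
      using k(2) mesh_step_pos[OF ab r i] mesh_step_total[OF r, of a b i] by simp
  qed
  then show "z \<in> cbox a b"
    by (simp add: mem_box)
qed

lemma element_vertices_are_grid_points:
  assumes "c \<in> element_corners a b r"
  shows "corner_points c (c + mesh_step a b r) \<subseteq> grid_points a b r"
proof
  fix z assume z: "z \<in> corner_points c (c + mesh_step a b r)"
  have "\<exists>k<r. z \<bullet> i = a \<bullet> i + real k * (mesh_step a b r \<bullet> i)" if i: "i \<in> Basis" for i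
  proof -
    obtain k where k: "Suc k < r" "c \<bullet> i = a \<bullet> i + real k * (mesh_step a b r \<bullet> i)"
      using assms i by (auto simp: element_corners_def)
    have "z \<bullet> i = c \<bullet> i \<or> z \<bullet> i = c \<bullet> i + mesh_step a b r \<bullet> i"
      using z i by (auto simp: corner_points_def inner_add_left)
    then show ?thesis
    proof
      assume "z \<bullet> i = c \<bullet> i"
      then show ?thesis using k by (intro exI[of _ k]) simp
    next
      assume "z \<bullet> i = c \<bullet> i + mesh_step a b r \<bullet> i"
      then show ?thesis using k by (intro exI[of _ "Suc k"]) (simp add: algebra_simps)
    qed
  qed
  then show "z \<in> grid_points a b r"
    by (simp add: grid_points_def)
qed

lemma cbox_covered_by_elements:
  fixes a b :: "'a::euclidean_space"
  assumes ab: "\<forall>i\<in>Basis. a \<bullet> i < b \<bullet> i" and r: "r \<ge> 2" and z: "z \<in> cbox a b"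
  obtains c where "c \<in> element_corners a b r" "z \<in> cbox c (c + mesh_step a b r)"
proof -
  let ?h = "mesh_step a b r"
  \<comment> \<open>The cap \<open>r - 2\<close> only matters on the upper face \<open>z \<bullet> i = b \<bullet> i\<close>, which belongs to the last element.\<close>
  define k where "k i = min (nat \<lfloor>(z \<bullet> i - a \<bullet> i) / (?h \<bullet> i)\<rfloor>) (r - 2)" for i
  define c where "c = (\<Sum>i\<in>Basis. (a \<bullet> i + real (k i) * (?h \<bullet> i)) *\<^sub>R i)"
  have c: "c \<bullet> i = a \<bullet> i + real (k i) * (?h \<bullet> i)" if "i \<in> Basis" for i
    using that by (simp add: c_def)
  have bounds: "c \<bullet> i \<le> z \<bullet> i \<and> z \<bullet> i \<le> c \<bullet> i + ?h \<bullet> i" if i: "i \<in> Basis" for i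
  proof -
    define t where "t = (z \<bullet> i - a \<bullet> i) / (?h \<bullet> i)"
    have h: "0 < ?h \<bullet> i"
      by (rule mesh_step_pos[OF ab r i])
    have zt: "z \<bullet> i = a \<bullet> i + t * (?h \<bullet> i)"
      using h by (simp add: t_def)
    have "0 \<le> t"
      using z i h by (simp add: t_def mem_box)
    have "t * (?h \<bullet> i) \<le> (real r - 1) * (?h \<bullet> i)"
      using z i zt mesh_step_total[OF r, of a b i] unfolding mem_box by fastforce
    then have "t \<le> real r - 1"
      using h by simp
    have "real (k i) \<le> t \<and> t \<le> real (k i) + 1"
    proof (cases "nat \<lfloor>t\<rfloor> \<le> r - 2")
      case True
      then have "k i = nat \<lfloor>t\<rfloor>" by (simp add: k_def t_def)
      then show ?thesis using \<open>0 \<le> t\<close> by linarith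
    next
      case False
      then have "k i = r - 2" by (simp add: k_def t_def)
      then show ?thesis using \<open>0 \<le> t\<close> \<open>t \<le> real r - 1\<close> False r by linarith
    qed
    then have "real (k i) * (?h \<bullet> i) \<le> t * (?h \<bullet> i)" "t * (?h \<bullet> i) \<le> (real (k i) + 1) * (?h \<bullet> i)"
      using h by (auto intro: mult_right_mono)
    then show ?thesis
      using zt c[OF i] by (simp add: algebra_simps)
  qed
  have "Suc (k i) < r" for i
    using r by (auto simp: k_def)
  then have "c \<in> element_corners a b r"
    using c by (auto simp: element_corners_def)
  moreover have "z \<in> cbox c (c + ?h)"
    using bounds by (simp add: mem_box inner_add_left)
  ultimately show ?thesis
    by (rule that)
qed

lemma mesh_interpolation_weights:
  fixes a b :: "'a::euclidean_space"
  assumes ab: "\<forall>i\<in>Basis. a \<bullet> i < b \<bullet> i" and r: "r \<ge> 2" and z: "z \<in> cbox a b"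
  obtains V w where "V \<subseteq> grid_points a b r" "\<And>v. v \<in> V \<Longrightarrow> 0 \<le> w v" "sum w V = 1"
    "(\<Sum>v\<in>V. w v *\<^sub>R v) = z"
    "(\<Sum>v\<in>V. w v * (norm (v - z))\<^sup>2) \<le> (simplex_ball_radius a b r)\<^sup>2"
    "0 \<le> simplex_ball_radius a b r"
proof -
  let ?h = "mesh_step a b r"
  have h: "\<And>i. i \<in> Basis \<Longrightarrow> 0 < ?h \<bullet> i"
    by (rule mesh_step_pos[OF ab r])
  obtain c where c: "c \<in> element_corners a b r" "z \<in> cbox c (c + ?h)"
    using cbox_covered_by_elements[OF ab r z] .
  obtain js where js: "distinct js" "set js = Basis" "z \<in> element_simplex c ?h js"
    using element_covered_by_simplices[OF h c(2)] .
  let ?S = "element_simplex c ?h js"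
  have "z \<in> convex hull (?S \<inter> corner_points c (c + ?h))"
    using element_simplex_subset_convex_hull[OF h js(1,2)] js(3) by blast
  then obtain V w where V: "V \<subseteq> ?S \<inter> corner_points c (c + ?h)"
      and w: "\<And>v. v \<in> V \<Longrightarrow> 0 \<le> w v" "sum w V = 1" "(\<Sum>v\<in>V. w v *\<^sub>R v) = z"
    unfolding convex_hull_explicit by blast
  have bdd: "bounded ?S"
    by (rule bounded_subset[OF bounded_cbox element_simplex_subset_element[OF h js(2)]])
  have "?S \<in> mesh_simplices a b r"
    using c(1) js(1,2) unfolding mesh_simplices_def by blast
  then have le: "min_ball_radius ?S \<le> simplex_ball_radius a b r"
    unfolding simplex_ball_radius_def by (intro Max_ge finite_imageI finite_mesh_simplices imageI)
  have nonneg: "0 \<le> min_ball_radius ?S"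
    using min_ball_radius_nonneg[OF bdd] js(3) by blast
  have "(\<Sum>v\<in>V. w v * (norm (v - z))\<^sup>2) \<le> (min_ball_radius ?S)\<^sup>2"
    using weighted_sq_dist_le_min_ball_radius[OF w _ bdd] V by blast
  also have "\<dots> \<le> (simplex_ball_radius a b r)\<^sup>2"
    using le nonneg by (rule power_mono)
  finally have "(\<Sum>v\<in>V. w v * (norm (v - z))\<^sup>2) \<le> (simplex_ball_radius a b r)\<^sup>2" .
  moreover have "V \<subseteq> grid_points a b r"
    using V element_vertices_are_grid_points[OF c(1)] by blast
  ultimately show ?thesis
    using that[of V w] w order.trans[OF nonneg le] by blast
qed

section \<open>Over-approximation by affine functions\<close>

lemma interpolation_error_le_error_bound:
  fixes f :: "'a::euclidean_space \<Rightarrow> real ^ 'n"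
  assumes ab: "\<forall>i\<in>Basis. a \<bullet> i < b \<bullet> i" and r: "r \<ge> 2"
    and lip: "\<exists>L. L-lipschitz_on (cbox a b) (\<lambda>z. f z $ k)"
    and V: "V \<subseteq> grid_points a b r" and w: "\<And>v. v \<in> V \<Longrightarrow> 0 \<le> w v" "sum w V = 1"
    "(\<Sum>v\<in>V. w v *\<^sub>R v) = z" and z: "z \<in> cbox a b"
    and var: "(\<Sum>v\<in>V. w v * (norm (v - z))\<^sup>2) \<le> (simplex_ball_radius a b r)\<^sup>2"
    and nonneg: "0 \<le> simplex_ball_radius a b r"
  shows "\<bar>(\<Sum>v\<in>V. w v * f v $ k) - f z $ k\<bar> \<le> error_bound a b r f $ k"
proof -
  let ?\<delta> = "simplex_ball_radius a b r"
  have cl: "cbox a b \<subseteq> closure (interior (cbox a b))"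
    using ab by (simp add: interior_cbox closure_box box_ne_empty)
  have "Min (applicable_bounds (cbox a b) ?\<delta> (\<lambda>z. f z $ k))
      \<in> applicable_bounds (cbox a b) ?\<delta> (\<lambda>z. f z $ k)"
    using finite_applicable_bounds[OF cl] lip by (intro Min_in) (auto simp: applicable_bounds_def)
  from interpolation_error_le_applicable_bound[OF convex_box(1) compact_cbox cl lip w _ z var nonneg this]
  show ?thesis
    using V grid_points_subset_cbox[OF ab r] by (simp add: error_bound_def)
qed

text \<open>The weights sum to \<open>1\<close>, so affine functions commute with the weighted mean.\<close>

lemma affine_component_weighted_sum:
  fixes A :: "real ^ 'n::finite ^ 'k" and B :: "real ^ 'm::finite ^ 'k"
  assumes F: "\<forall>x u. F (x, u) = A *v x + B *v u + d"
    and w: "sum w V = 1" "(\<Sum>v\<in>V. w v *\<^sub>R v) = z"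
  shows "(\<Sum>v\<in>V. w v * F v $ k) = F z $ k"
proof -
  define l where "l v = (A *v fst v + B *v snd v) $ k" for v
  have "linear l"
    unfolding l_def by (rule linearI) (simp_all add: matrix_vector_right_distrib matrix_vector_mult_scaleR distrib_left)
  have Fl: "F v $ k = l v + d $ k" for v
    using F by (cases v) (simp add: l_def)
  have "(\<Sum>v\<in>V. w v * F v $ k) = (\<Sum>v\<in>V. w v * l v) + sum w V * d $ k"
    by (simp add: Fl distrib_left sum.distrib sum_distrib_right)
  also have "(\<Sum>v\<in>V. w v * l v) = l z"
    using \<open>linear l\<close> by (simp add: linear_sum linear_scale flip: w(2))
  finally show ?thesis
    by (simp add: Fl w(1))
qed

theorem theorem1:
  fixes a b :: "(real ^ 'n) \<times> (real ^ 'm)"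
    and f :: "(real ^ 'n) \<times> (real ^ 'm) \<Rightarrow> real ^ 'n"
    and r :: nat
    and \<theta> :: real
    and Au Al :: "real ^ 'n ^ 'n"
    and Bu Bl :: "real ^ 'm ^ 'n"
    and hu hb \<sigma> :: "real ^ 'n"
    and fu fb f_upper f_lower :: "(real ^ 'n) \<times> (real ^ 'm) \<Rightarrow> real ^ 'n"
  assumes "\<forall>i\<in>Basis. a \<bullet> i < b \<bullet> i"
    and "r \<ge> 2"
    and "continuous_on (cbox a b) f"
    and "\<forall>k. \<exists>L. L-lipschitz_on (cbox a b) (\<lambda>z. f z $ k)"
    and "\<sigma> = error_bound a b r f"
    and "lp_optimal (grid_points a b r) (corner_points a b) f (\<theta>, Au, Al, Bu, Bl, hu, hb)"
    and "\<forall>x u. fu (x, u) = Au *v x + Bu *v u + hu"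
    and "\<forall>x u. fb (x, u) = Al *v x + Bl *v u + hb"
    and "\<forall>z. f_upper z = fu z + \<sigma>"
    and "\<forall>z. f_lower z = fb z - \<sigma>"
  shows "\<forall>(x, u)\<in>cbox a b. f_lower (x, u) \<le> f (x, u) \<and> f (x, u) \<le> f_upper (x, u)"
proof (clarify)
  fix x u assume z: "(x, u) \<in> cbox a b"
  obtain V w where V: "V \<subseteq> grid_points a b r"
    and w: "\<And>v. v \<in> V \<Longrightarrow> 0 \<le> w v" "sum w V = 1" "(\<Sum>v\<in>V. w v *\<^sub>R v) = (x, u)"
    and var: "(\<Sum>v\<in>V. w v * (norm (v - (x, u)))\<^sup>2) \<le> (simplex_ball_radius a b r)\<^sup>2"
      "0 \<le> simplex_ball_radius a b r"
    using mesh_interpolation_weights[OF assms(1,2) z] by blast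
  have grid: "f v $ k \<le> fu v $ k \<and> fb v $ k \<le> f v $ k" if "v \<in> V" for v k
  proof -
    have "(fst v, snd v) \<in> grid_points a b r"
      using V that by auto
    moreover have "\<forall>(x, u)\<in>grid_points a b r. f (x, u) \<le> fu (x, u) \<and> fb (x, u) \<le> f (x, u)"
      using assms(6) unfolding assms(7)[rule_format] assms(8)[rule_format]
      by (auto simp: lp_optimal_def lp_feasible_def)
    ultimately have "f v \<le> fu v \<and> fb v \<le> f v"
      by fastforce
    then show ?thesis
      by (simp add: less_eq_vec_def)
  qed
  have "f_lower (x, u) $ k \<le> f (x, u) $ k \<and> f (x, u) $ k \<le> f_upper (x, u) $ k" for k
  proof -
    have "\<bar>(\<Sum>v\<in>V. w v * f v $ k) - f (x, u) $ k\<bar> \<le> \<sigma> $ k"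
      unfolding assms(5) using assms(4)
      by (intro interpolation_error_le_error_bound[OF assms(1,2) _ V w z var]) auto
    moreover have "(\<Sum>v\<in>V. w v * f v $ k) \<le> fu (x, u) $ k"
      unfolding affine_component_weighted_sum[OF assms(7) w(2,3), symmetric]
      using w(1) grid by (intro sum_mono mult_left_mono) auto
    moreover have "fb (x, u) $ k \<le> (\<Sum>v\<in>V. w v * f v $ k)"
      unfolding affine_component_weighted_sum[OF assms(8) w(2,3), symmetric]
      using w(1) grid by (intro sum_mono mult_left_mono) auto
    ultimately show ?thesis
      unfolding assms(9,10)[rule_format] vector_add_component vector_minus_component by linarith
  qed
  then show "f_lower (x, u) \<le> f (x, u) \<and> f (x, u) \<le> f_upper (x, u)"
    by (simp add: less_eq_vec_def)
qed

end
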